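(* If a Fano polygon $P$ has singularity content $(2,\mathcal{B})$ and is such that the primitive inner normal vectors of the two edges corresponding to the two primitive $T$-cones form a basis of the dual lattice $M$, then the mutation-equivalence class of $P$ has at most five members (counted up to $GL_2(\mathbb{Z})$-equivalence).
   Context: Let $N\cong\mathbb{Z}^2$, $N_{\mathbb{Q}}=N\otimes_{\mathbb{Z}}\mathbb{Q}$, $M=\operatorname{Hom}(N,\mathbb{Z})$. A Fano polygon is a convex polygon $P\subset N_{\mathbb{Q}}$ whose vertices are primitive lattice points of $N$ and which contains the origin in its strict interior; polygons are considered up to $GL_2(\mathbb{Z})$-equivalence. Singularity content. For an edge $E$ of $P$ with primitive inner normal $w_E\in M$, the height is $r_E=-w_E(E)>0$ and the width is $k_E=|E\cap N|-1$. Write $k_E=n_Er_E+k_0$ with $0\leq k_0<r_E$. The edge can be subdivided into $n_E$ lattice segments of width $r_E$, whose cones are called primitive $T$-cones (each determines, i.e. corresponds to, the edge $E$), and, if $k_0\neq 0$, one lattice segment of width $k_0$, whose associated cyclic quotient singularity (the residue) is independent of the subdivision. The singularity content of $P$ is $(n,\mathcal{B})$ with $n=\sum_E n_E$ and $\mathcal{B}$ the cyclically ordered list of the residues over all edges with $k_0\neq 0$. Mutation. Let $w\in M$ be the primitive inner normal vector of an edge $E$ of $P$, let $h_{\min}=\min_{v\in P}w(v)=-r_E<0$ and $h_{\max}=\max_{v\in P}w(v)>0$. For $h\in\mathbb{Z}$ let $w_h(P)$ be the (possibly empty) convex hull of $\{v\in P\cap N: w(v)=h\}$. Let $v_E\in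 N$ be primitive with $w(v_E)=0$ (unique up to sign) and $F=\operatorname{conv}\{0,v_E\}$. Suppose that for every integer $h$ with $h_{\min}\leq h<0$ there is a (possibly empty) lattice polytope $G_h\subset N_{\mathbb{Q}}$ with $\{v \text{ a vertex of } P: w(v)=h\}\subseteq G_h+|h|F\subseteq w_h(P)$ (Minkowski sum, with $\varnothing+Q=\varnothing$). Then the mutation of $P$ is $\operatorname{mut}_w(P,F)=\operatorname{conv}\big(\bigcup_{h=h_{\min}}^{-1}G_h\cup\bigcup_{h=0}^{h_{\max}}(w_h(P)+hF)\big)$. It is again a Fano polygon, is independent of the choice of $\{G_h\}$, and up to $GL_2(\mathbb{Z})$ is independent of the sign of $v_E$. Two Fano polygons are mutation-equivalent if, up to $GL_2(\mathbb{Z})$-equivalence, they are connected by a finite sequence of mutations. *)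

theory Defs
  imports "HOL-Analysis.Analysis" "HOL-Library.Multiset"
begin

text \<open>
  The lattice N is the set of integer points of the real plane. Polygons live in
  the real rather than the rational plane, so that the convexity library applies; a lattice
  polygon is the hull of its vertices in either setting, so this does not change the notion.
  The lattice M = Hom(N, Z) is identified, via the inner product, with the
  vectors that pair integrally with N.
\<close>

definition lattice_N :: "(real^2) set" where
  "lattice_N = {v. \<forall>i. v $ i \<in> \<int>}"

definition lattice_M :: "(real^2) set" where
  "lattice_M = {w. \<forall>v\<in>lattice_N. w \<bullet> v \<in> \<int>}"

definition primitive_in :: "(real^2) set \<Rightarrow> real^2 \<Rightarrow> bool" where
  "primitive_in L v \<longleftrightarrow>
     v \<in> L \<and> v \<noteq> 0 \<and> (\<forall>u\<in>L. \<forall>k::int. v = of_int k *\<^sub>R u \<longrightarrow> \<bar>k\<bar> = 1)"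

definition lattice_basis :: "(real^2) set \<Rightarrow> real^2 \<Rightarrow> real^2 \<Rightarrow> bool" where
  "lattice_basis L u v \<longleftrightarrow>
     u \<in> L \<and> v \<in> L \<and>
     (\<forall>w\<in>L. \<exists>!c :: int \<times> int. w = of_int (fst c) *\<^sub>R u + of_int (snd c) *\<^sub>R v)"

definition lattice_polytope :: "(real^2) set \<Rightarrow> bool" where
  "lattice_polytope G \<longleftrightarrow> (\<exists>V. finite V \<and> V \<subseteq> lattice_N \<and> G = convex hull V)"

definition GL2Z :: "(real^2^2) set" where
  "GL2Z = {A. (\<forall>i j. A $ i $ j \<in> \<int>) \<and> \<bar>det A\<bar> = 1}"

definition gl2_equivalent :: "(real^2) set \<Rightarrow> (real^2) set \<Rightarrow> bool" where
  "gl2_equivalent P Q \<longleftrightarrow> (\<exists>A\<in>GL2Z. Q = (*v) A ` P)"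

definition fano_polygon :: "(real^2) set \<Rightarrow> bool" where
  "fano_polygon P \<longleftrightarrow>
     polytope P \<and> 0 \<in> interior P \<and> (\<forall>v. v extreme_point_of P \<longrightarrow> primitive_in lattice_N v)"


section \<open>Singularity content\<close>

definition inner_normal :: "(real^2) set \<Rightarrow> (real^2) set \<Rightarrow> real^2" where
  "inner_normal P E =
     (THE w. primitive_in lattice_M w \<and> E = {v \<in> P. \<forall>u\<in>P. w \<bullet> v \<le> w \<bullet> u})"

definition edge_height :: "(real^2) set \<Rightarrow> (real^2) set \<Rightarrow> nat" where
  "edge_height P E = (THE r. \<forall>v\<in>E. inner_normal P E \<bullet> v = - real r)"

definition lattice_width :: "(real^2) set \<Rightarrow> nat" where
  "lattice_width S = card (S \<inter> lattice_N) - 1"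

definition T_count :: "(real^2) set \<Rightarrow> (real^2) set \<Rightarrow> nat" where
  "T_count P E = lattice_width E div edge_height P E"

definition residue_width :: "(real^2) set \<Rightarrow> (real^2) set \<Rightarrow> nat" where
  "residue_width P E = lattice_width E mod edge_height P E"

text \<open>
  The edges of the primitive T-cones, listed with multiplicity: an edge with
  \<open>T_count P E = m\<close> carries m primitive T-cones.
\<close>

definition T_cone_edges :: "(real^2) set \<Rightarrow> (real^2) set multiset" where
  "T_cone_edges P = (\<Sum>E | E edge_of P. replicate_mset (T_count P E) E)"

text \<open>
  The segments of the residual width that occur in some subdivision of the edge whose other
  pieces all have width equal to the height.
\<close>

definition residue_segment :: "(real^2) set \<Rightarrow> (real^2) set \<Rightarrow> (real^2) set \<Rightarrow> bool" where
  "residue_segment P E S \<longleftrightarrow>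
     (\<exists>p q a b. E = closed_segment p q \<and> S = closed_segment a b \<and>
        a \<in> E \<inter> lattice_N \<and> b \<in> E \<inter> lattice_N \<and> a \<in> closed_segment p b \<and>
        lattice_width S = residue_width P E \<and>
        edge_height P E dvd lattice_width (closed_segment p a) \<and>
        edge_height P E dvd lattice_width (closed_segment b q))"

text \<open>
  A cyclic quotient singularity is given by a two-dimensional cone up to GL2(Z), and is
  represented by the orbit of that cone. All residue segments of an edge give
  the same orbit, so the set below is a single orbit.
\<close>

type_synonym singularity = "(real^2) set set"

definition residue :: "(real^2) set \<Rightarrow> (real^2) set \<Rightarrow> singularity" where
  "residue P E = {(*v) A ` (conic hull S) |A S. A \<in> GL2Z \<and> residue_segment P E S}"

text \<open>
  The edges in counterclockwise order around the origin, starting anywhere.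
\<close>

definition edge_cycle :: "(real^2) set \<Rightarrow> (real^2) set list \<Rightarrow> bool" where
  "edge_cycle P Es \<longleftrightarrow>
     distinct Es \<and> set Es = {E. E edge_of P} \<and>
     (\<forall>i<length Es. \<exists>p q s.
        Es ! i = closed_segment p q \<and> Es ! (Suc i mod length Es) = closed_segment q s \<and>
        0 < det (vector [p, q] :: real^2^2) \<and> 0 < det (vector [q, s] :: real^2^2))"

text \<open>
  The cyclically ordered list of residues is represented by the set of all its
  rotations.
\<close>

definition singularity_content :: "(real^2) set \<Rightarrow> nat \<times> singularity list set" where
  "singularity_content P =
     ((\<Sum>E | E edge_of P. T_count P E),
      {map (residue P) (filter (\<lambda>E. residue_width P E \<noteq> 0) Es) |Es. edge_cycle P Es})"


section \<open>Mutation\<close>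

definition slice :: "real^2 \<Rightarrow> int \<Rightarrow> (real^2) set \<Rightarrow> (real^2) set" where
  "slice w h P = convex hull {v \<in> P \<inter> lattice_N. w \<bullet> v = of_int h}"

text \<open>
  \<open>+\<close> on sets is the Minkowski sum, and \<open>(*\<^sub>R) c ` F\<close> is the dilation of
  \<open>F\<close> by \<open>c\<close>.
\<close>

definition mutation_data ::
    "(real^2) set \<Rightarrow> real^2 \<Rightarrow> (real^2) set \<Rightarrow> (int \<Rightarrow> (real^2) set) \<Rightarrow> bool" where
  "mutation_data P w F G \<longleftrightarrow>
     (\<forall>h::int. (INF v\<in>P. w \<bullet> v) \<le> of_int h \<and> h < 0 \<longrightarrow>
        lattice_polytope (G h) \<and>
        {v. v extreme_point_of P \<and> w \<bullet> v = of_int h} \<subseteq> G h + (*\<^sub>R) (of_int \<bar>h\<bar>) ` F \<and>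
        G h + (*\<^sub>R) (of_int \<bar>h\<bar>) ` F \<subseteq> slice w h P)"

definition mut ::
    "(real^2) set \<Rightarrow> real^2 \<Rightarrow> (real^2) set \<Rightarrow> (int \<Rightarrow> (real^2) set) \<Rightarrow> (real^2) set" where
  "mut P w F G = convex hull
     ((\<Union>h\<in>{h::int. (INF v\<in>P. w \<bullet> v) \<le> of_int h \<and> h < 0}. G h) \<union>
      (\<Union>h\<in>{h::int. 0 \<le> h \<and> of_int h \<le> (SUP v\<in>P. w \<bullet> v)}.
         slice w h P + (*\<^sub>R) (of_int h) ` F))"

definition is_mutation :: "(real^2) set \<Rightarrow> (real^2) set \<Rightarrow> bool" where
  "is_mutation P Q \<longleftrightarrow>
     fano_polygon P \<and>
     (\<exists>E w v F G. E edge_of P \<and> w = inner_normal P E \<and>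
        primitive_in lattice_N v \<and> w \<bullet> v = 0 \<and> F = convex hull {0, v} \<and>
        mutation_data P w F G \<and> Q = mut P w F G)"

text \<open>
  Mutations are invertible (up to GL2(Z)), so being connected by a finite sequence of mutations
  is a symmetric relation.
\<close>

definition mutation_equivalent :: "(real^2) set \<Rightarrow> (real^2) set \<Rightarrow> bool" where
  "mutation_equivalent P Q \<longleftrightarrow>
     fano_polygon P \<and> fano_polygon Q \<and>
     (\<lambda>X Y. is_mutation X Y \<or> gl2_equivalent X Y)\<^sup>*\<^sup>* P Q"

definition mutation_class :: "(real^2) set \<Rightarrow> (real^2) set set" where
  "mutation_class P = {Q. mutation_equivalent P Q}"

end

theory Submission
  imports Defs
begin

text \<open>
  A polygon \<open>P\<close> is determined by its lower support function, which sends a covector \<open>u\<close> to the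
  minimum of \<open>u\<close> on \<open>P\<close> (\<open>lower_support_inject\<close>). On this side mutation is a change of
  variables: mutating in direction \<open>w\<close> with factor \<open>conv {0, v}\<close> precomposes the function with the
  piecewise linear bijection \<open>u \<mapsto> u + min 0 (u \<bullet> v) w\<close> of the dual plane (\<open>lower_support_mut\<close>).
  Suppose that the directions of the T-cones form a basis of the dual lattice. In
  the coordinates of that basis, and up to a unimodular change of coordinates, the mutations in the
  first and the second direction precompose the function with

    \<open>pent (a, b) = (min 0 a - b, a)\<close>

  and with its inverse. Iterating \<open>pent\<close> is the tropical A2 cluster recurrence, which has period
  five. So if \<open>f\<close> is the function of the initial polygon in these coordinates, every polygon in the
  class has the function \<open>f \<circ> pent ^^ k\<close> with \<open>k < 5\<close> in suitable unimodular coordinates, and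
  polygons with the same \<open>k\<close> are equivalent.

  It remains to see that no polygon in the class can be mutated in a third direction. For a
  primitive covector \<open>u\<close>, the height of the corresponding face is minus the value of the support
  function at \<open>u\<close>, and the lattice width of the face is the bend of the function across the ray of
  \<open>u\<close>, that is, the difference of its slopes on the two sides. A mutation in
  direction \<open>u\<close> requires the width to be at least the height (\<open>mutation_kink\<close>). Initially this happens
  in the two basis directions only, and there the width is less than twice the height
  (\<open>A2_pattern_lower_support\<close>). Composition with \<open>pent\<close> preserves this pattern
  (\<open>A2_pattern_pent\<close>): \<open>pent\<close> is locally unimodular off one line, and its fold along that line
  lowers the width of one face and raises that of the opposite face, each by its own height.
\<close>

section \<open>Bends of positively homogeneous functions and the pentagon map\<close>

definition det2 :: "real^2 \<Rightarrow> real^2 \<Rightarrow> real" where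
  "det2 u v = u $ 1 * v $ 2 - u $ 2 * v $ 1"

definition pos_homogeneous :: "(real^2 \<Rightarrow> real) \<Rightarrow> bool" where
  "pos_homogeneous f \<longleftrightarrow> (\<forall>c>0. \<forall>u. f (c *\<^sub>R u) = c * f u)"

text \<open>
  The functions of interest are piecewise linear, so the one-sided directional derivative exists
  in the strong form that the difference quotient is eventually constant. That form survives
  composition with a piecewise linear map without any limit argument.
\<close>
definition slope :: "(real^2 \<Rightarrow> real) \<Rightarrow> real^2 \<Rightarrow> real^2 \<Rightarrow> real \<Rightarrow> bool" where
  "slope f u v a \<longleftrightarrow> (\<forall>\<^sub>F t in at_right 0. f (u + t *\<^sub>R v) = f u + t * a)"

lemma slope_unique:
  assumes "slope f u v a" "slope f u v b"
  shows "a = b"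
proof -
  have "\<forall>\<^sub>F t in at_right (0::real). a = b"
    using assms[unfolded slope_def] eventually_at_right_less[of "0::real"]
    by eventually_elim simp
  then show ?thesis by simp
qed

text \<open>
  Homogeneity makes the slope along the ray through \<open>u\<close> equal to \<open>f u\<close>. Hence the bend
  \<open>- a - b\<close> formed from the slopes along \<open>v\<close> and \<open>- v\<close> depends only on \<open>det2 u v\<close>.
\<close>
lemma slope_add_multiple:
  assumes f: "pos_homogeneous f" and s: "slope f u v a"
  shows "slope f u (v + c *\<^sub>R u) (a + c * f u)"
proof -
  obtain b where b: "b > 0" "\<And>t. 0 < t \<Longrightarrow> t < b \<Longrightarrow> f (u + t *\<^sub>R v) = f u + t * a"
    using s unfolding slope_def eventually_at_right_field by blast
  have "f (u + t *\<^sub>R (v + c *\<^sub>R u)) = f u + t * (a + c * f u)"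
    if t: "0 < t" "t < min (b / 2) (1 / (2 * (\<bar>c\<bar> + 1)))" for t
  proof -
    have "t * (\<bar>c\<bar> + 1) < 1 / 2" using t by (simp add: field_simps)
    moreover have "\<bar>t * c\<bar> \<le> t * (\<bar>c\<bar> + 1)" using t by (simp add: abs_mult)
    ultimately have k: "1 + t * c > 1 / 2" by linarith
    define k where "k = 1 + t * c"
    have k0: "k > 1/2" using k k_def by simp
    have "b * (1 / 2) < b * k" using b(1) k0 by (intro mult_strict_left_mono) auto
    then have "t < b * k" using t by linarith
    then have "t / k < b" using k0 by (simp add: pos_divide_less_eq)
    then have "f (u + (t / k) *\<^sub>R v) = f u + (t / k) * a" using b(2) t k0 by simp
    moreover have "k *\<^sub>R (u + (t / k) *\<^sub>R v) = k *\<^sub>R u + t *\<^sub>R v"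
      using k0 by (simp add: scaleR_add_right)
    moreover have "k *\<^sub>R u + t *\<^sub>R v = u + t *\<^sub>R (v + c *\<^sub>R u)"
      by (simp add: k_def algebra_simps)
    ultimately have "f (u + t *\<^sub>R (v + c *\<^sub>R u)) = k * (f u + (t / k) * a)"
      using f k0 unfolding pos_homogeneous_def
      by (metis less_trans half_gt_zero zero_less_one)
    also have "\<dots> = k * f u + t * a" using k0 by (simp add: field_simps)
    finally show ?thesis by (simp add: k_def algebra_simps)
  qed
  then show ?thesis unfolding slope_def eventually_at_right_field
    using b(1) by (intro exI[of _ "min (b / 2) (1 / (2 * (\<bar>c\<bar> + 1)))"]) auto
qed

text \<open>
  If \<open>f\<close> is the lower support function of a Fano polygon and \<open>u\<close> is primitive, then \<open>- f u\<close> is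
  the height of the face with inner normal \<open>u\<close> and the bend \<open>- a - b\<close> is its lattice width. The
  integer part of width over height counts the primitive T-cones, so the condition says that the
  two basis directions carry at most one each and that no other direction carries any. The upper
  bound in the two basis directions ensures that mutating there uses up the T-cone.
\<close>
definition A2_pattern :: "(real^2 \<Rightarrow> real) \<Rightarrow> bool" where
  "A2_pattern f \<longleftrightarrow>
     (\<forall>u\<in>lattice_N. \<forall>v\<in>lattice_N. \<forall>a b.
        det2 u v = 1 \<and> slope f u v a \<and> slope f u (- v) b \<longrightarrow>
        - a - b < (if u = axis 1 1 \<or> u = axis 2 1 then 2 else 1) * - f u)"

text \<open>
  The tropical form of the A2 cluster recurrence \<open>x (n + 1) + x (n - 1) = min 0 (x n)\<close>, acting
  on pairs of consecutive terms. All its sequences have period five.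
\<close>
definition pent :: "real^2 \<Rightarrow> real^2" where
  "pent u = vector [min 0 (u $ 1) - u $ 2, u $ 1]"

lemma pent_nth [simp]: "pent u $ 1 = min 0 (u $ 1) - u $ 2" "pent u $ 2 = u $ 1"
  by (simp_all add: pent_def)

lemma vec2_eq_iff: "u = v \<longleftrightarrow> u $ 1 = v $ 1 \<and> u $ 2 = v $ 2" for u v :: "'a^2"
  by (simp add: vec_eq_iff forall_2)

lemma axis2_nth [simp]:
  "axis 1 (x::real) $ (1::2) = x" "axis 1 x $ (2::2) = 0"
  "axis 2 x $ (1::2) = 0" "axis 2 x $ (2::2) = x"
  by (simp_all add: axis_def)

lemma lattice_N_iff: "u \<in> lattice_N \<longleftrightarrow> u $ 1 \<in> \<int> \<and> u $ 2 \<in> \<int>"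
  by (simp add: lattice_N_def forall_2)

lemma pent_period: "(pent ^^ 5) u = u"
  by (auto simp: eval_nat_numeral vec2_eq_iff min_def)

lemma pos_homogeneous_pent:
  assumes "pos_homogeneous f" shows "pos_homogeneous (f \<circ> pent)"
proof -
  have "pent (c *\<^sub>R u) = c *\<^sub>R pent u" if "c > 0" for c u
    using that by (auto simp: vec2_eq_iff min_def algebra_simps zero_le_mult_iff mult_le_0_iff)
  then show ?thesis using assms by (simp add: pos_homogeneous_def)
qed

lemma slope_transfer:
  assumes "slope (f \<circ> pent) u v a"
    and "\<forall>\<^sub>F t in at_right 0. pent (u + t *\<^sub>R v) = pent u + t *\<^sub>R v'"
  shows "slope f (pent u) v' a"
  unfolding slope_def using assms(1)[unfolded slope_def] assms(2)
  by eventually_elim auto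

lemma eventually_keeps_sign:
  fixes x y :: real
  assumes "x > 0" shows "\<forall>\<^sub>F t in at_right 0. x + t * y > 0"
proof -
  have "((\<lambda>t. x + t * y) \<longlongrightarrow> x + 0 * y) (at_right 0)" by (intro tendsto_intros)
  then show ?thesis using assms order_tendstoD(1) by fastforce
qed

text \<open>
  Away from the line \<open>u $ 1 = 0\<close> the map \<open>pent\<close> is locally a unimodular linear map \<open>L\<close>, so
  heights and widths are carried over; only \<open>axis 1 1\<close> is sent there to a basis direction, namely
  to \<open>axis 2 1\<close>. The fold along the line \<open>u $ 1 = 0\<close> changes the width by exactly the height: at
  \<open>axis 2 1\<close> the width of the direction \<open>- axis 1 1\<close> of \<open>f\<close>, which was below the height, goes up
  by it, and at \<open>- axis 2 1\<close> the width of the direction \<open>axis 1 1\<close> of \<open>f\<close>, which was below twice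
  the height, goes down by it.
\<close>
lemma A2_pattern_pent:
  assumes hom: "pos_homogeneous f" and f: "A2_pattern f"
  shows "A2_pattern (f \<circ> pent)"
  unfolding A2_pattern_def
proof (intro ballI allI impI, elim conjE)
  fix u v a b
  assume u: "u \<in> lattice_N" and v: "v \<in> lattice_N" and d: "det2 u v = 1"
    and a: "slope (f \<circ> pent) u v a" and b: "slope (f \<circ> pent) u (- v) b"
  have bound: "- a' - b' < (if u' = axis 1 1 \<or> u' = axis 2 1 then 2 else 1) * - f u'"
    if "u' \<in> lattice_N" "v' \<in> lattice_N" "det2 u' v' = 1" "slope f u' v' a'" "slope f u' (- v') b'"
    for u' v' a' b'
    using f that unfolding A2_pattern_def by blast
  consider (pos) "u $ 1 > 0" | (neg) "u $ 1 < 0" | (zero) "u $ 1 = 0" by linarith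
  then show "- a - b < (if u = axis 1 1 \<or> u = axis 2 1 then 2 else 1) * - (f \<circ> pent) u"
  proof cases
    case pos
    define L :: "real^2 \<Rightarrow> real^2" where "L = (\<lambda>v. vector [- v $ 2, v $ 1])"
    have ev: "\<forall>\<^sub>F t in at_right 0. pent (u + t *\<^sub>R x) = pent u + t *\<^sub>R L x" for x
      using eventually_keeps_sign[OF pos, of "x $ 1"]
      by eventually_elim (use pos in \<open>auto simp: vec2_eq_iff L_def min_def algebra_simps\<close>)
    have L: "L (- v) = - L v" by (simp add: L_def vec2_eq_iff)
    have "- a - b < (if pent u = axis 1 1 \<or> pent u = axis 2 1 then 2 else 1) * - f (pent u)"
    proof (rule bound)
      show "pent u \<in> lattice_N" using u pos by (auto simp: lattice_N_iff min_def)
      show "L v \<in> lattice_N" using v by (auto simp: lattice_N_iff L_def)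
      show "det2 (pent u) (L v) = 1" using d pos by (auto simp: det2_def L_def min_def algebra_simps)
      show "slope f (pent u) (L v) a" by (rule slope_transfer[OF a ev])
      show "slope f (pent u) (- L v) b" using slope_transfer[OF b ev] L by simp
    qed
    moreover have "pent u = axis 2 1 \<longleftrightarrow> u = axis 1 1" "pent u \<noteq> axis 1 1" "u \<noteq> axis 2 1"
      using pos by (auto simp: vec2_eq_iff min_def)
    ultimately show ?thesis by simp
  next
    case neg
    define L :: "real^2 \<Rightarrow> real^2" where "L = (\<lambda>v. vector [v $ 1 - v $ 2, v $ 1])"
    have neg': "- u $ 1 > 0" using neg by simp
    have ev: "\<forall>\<^sub>F t in at_right 0. pent (u + t *\<^sub>R x) = pent u + t *\<^sub>R L x" for x
      using eventually_keeps_sign[OF neg', of "- x $ 1"]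
      by eventually_elim (use neg in \<open>auto simp: vec2_eq_iff L_def min_def algebra_simps\<close>)
    have L: "L (- v) = - L v" by (simp add: L_def vec2_eq_iff)
    have "- a - b < (if pent u = axis 1 1 \<or> pent u = axis 2 1 then 2 else 1) * - f (pent u)"
    proof (rule bound)
      show "pent u \<in> lattice_N" using u neg by (auto simp: lattice_N_iff min_def)
      show "L v \<in> lattice_N" using v by (auto simp: lattice_N_iff L_def)
      show "det2 (pent u) (L v) = 1" using d neg by (auto simp: det2_def L_def min_def algebra_simps)
      show "slope f (pent u) (L v) a" by (rule slope_transfer[OF a ev])
      show "slope f (pent u) (- L v) b" using slope_transfer[OF b ev] L by simp
    qed
    moreover have "pent u \<noteq> axis 2 1" "u \<noteq> axis 1 1" "pent u \<noteq> axis 1 1" "u \<noteq> axis 2 1"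
      using neg by (auto simp: vec2_eq_iff min_def)
    ultimately show ?thesis by simp
  next
    case zero
    have "u $ 2 * v $ 1 = - 1" using d zero by (simp add: det2_def)
    moreover obtain m n where mn: "u $ 2 = of_int m" "v $ 1 = of_int n"
      using u v by (auto simp: lattice_N_iff elim!: Ints_cases)
    ultimately have "real_of_int (m * - n) = of_int 1" by simp
    then have "m * - n = 1" by (simp only: of_int_eq_iff)
    then have "(m = 1 \<and> n = - 1) \<or> (m = - 1 \<and> n = 1)" unfolding zmult_eq_1_iff by auto
    then consider (up) "u $ 2 = 1" "v $ 1 = -1" | (down) "u $ 2 = - 1" "v $ 1 = 1"
      using mn by auto
    then show ?thesis
    proof cases
      case up
      \<comment> \<open>The slopes at \<open>u\<close> along \<open>v\<close> and \<open>- v\<close> are those at \<open>pent u\<close> along \<open>v'\<close> and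
        \<open>- v' + pent u\<close>. The extra summand is the change of the bend by one height.\<close>
      define v' :: "real^2" where "v' = vector [- 1 - v $ 2, - 1]"
      have pu: "pent u = - axis 1 1" using zero up by (simp add: vec2_eq_iff)
      have a': "slope f (pent u) v' a"
        by (rule slope_transfer[OF a], rule eventually_mono[OF eventually_at_right_less])
          (auto simp: vec2_eq_iff zero up v'_def min_def algebra_simps)
      have b': "slope f (pent u) (- v' + 1 *\<^sub>R pent u) b"
        by (rule slope_transfer[OF b], rule eventually_mono[OF eventually_at_right_less])
          (auto simp: vec2_eq_iff zero up v'_def min_def algebra_simps)
      have "- v' = (- v' + 1 *\<^sub>R pent u) + (- 1) *\<^sub>R pent u" by simp
      then have b'': "slope f (pent u) (- v') (b + (- 1) * f (pent u))"
        using slope_add_multiple[OF hom b'] by metis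
      have "- a - (b + (- 1) * f (pent u)) <
          (if pent u = axis 1 1 \<or> pent u = axis 2 1 then 2 else 1) * - f (pent u)"
      proof (rule bound)
        show "pent u \<in> lattice_N" using u zero by (auto simp: lattice_N_iff min_def)
        show "v' \<in> lattice_N" using v by (auto simp: lattice_N_iff v'_def)
        show "det2 (pent u) v' = 1" by (simp add: det2_def v'_def pu)
      qed (use a' b'' in auto)
      moreover have "pent u \<noteq> axis 1 1" "pent u \<noteq> axis 2 1" "u = axis 2 1"
        using zero up by (auto simp: vec2_eq_iff)
      ultimately show ?thesis by simp
    next
      case down
      define v' :: "real^2" where "v' = vector [- v $ 2, 1]"
      have pu: "pent u = axis 1 1" using zero down by (simp add: vec2_eq_iff)
      have a': "slope f (pent u) v' a"
        by (rule slope_transfer[OF a], rule eventually_mono[OF eventually_at_right_less])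
          (auto simp: vec2_eq_iff zero down v'_def min_def algebra_simps)
      have b': "slope f (pent u) (- v' + (- 1) *\<^sub>R pent u) b"
        by (rule slope_transfer[OF b], rule eventually_mono[OF eventually_at_right_less])
          (auto simp: vec2_eq_iff zero down v'_def min_def algebra_simps)
      have "- v' = (- v' + (- 1) *\<^sub>R pent u) + 1 *\<^sub>R pent u" by simp
      then have b'': "slope f (pent u) (- v') (b + 1 * f (pent u))"
        using slope_add_multiple[OF hom b'] by metis
      have "- a - (b + 1 * f (pent u)) <
          (if pent u = axis 1 1 \<or> pent u = axis 2 1 then 2 else 1) * - f (pent u)"
      proof (rule bound)
        show "pent u \<in> lattice_N" using u zero by (auto simp: lattice_N_iff min_def)
        show "v' \<in> lattice_N" using v by (auto simp: lattice_N_iff v'_def)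
        show "det2 (pent u) v' = 1" by (simp add: det2_def v'_def pu)
      qed (use a' b'' in auto)
      moreover have "u \<noteq> axis 1 1" "u \<noteq> axis 2 1"
        using zero down by (auto simp: vec2_eq_iff)
      ultimately show ?thesis using pu by simp
    qed
  qed
qed

section \<open>Lower support functions of Fano polygons\<close>

definition lower_support :: "(real^2) set \<Rightarrow> real^2 \<Rightarrow> real" where
  "lower_support P u = (INF x\<in>P. u \<bullet> x)"

definition face :: "(real^2) set \<Rightarrow> real^2 \<Rightarrow> (real^2) set" where
  "face P w = {v \<in> P. \<forall>u\<in>P. w \<bullet> v \<le> w \<bullet> u}"

lemma inner_vec2: "u \<bullet> v = u $ 1 * v $ 1 + u $ 2 * v $ 2" for u v :: "real^2"
  by (simp add: inner_vec_def sum_2)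

lemma lattice_M_eq: "lattice_M = lattice_N"
proof (intro set_eqI iffI)
  fix w assume "w \<in> lattice_M"
  then have "w \<bullet> axis i 1 \<in> \<int>" for i
    by (auto simp: lattice_M_def lattice_N_def axis_def)
  from this[of 1] this[of 2] show "w \<in> lattice_N" by (simp add: inner_vec2 lattice_N_iff)
qed (auto simp: lattice_M_def lattice_N_iff inner_vec2)

lemma lattice_inner_Ints: "u \<in> lattice_N \<Longrightarrow> v \<in> lattice_N \<Longrightarrow> u \<bullet> v \<in> \<int>"
  by (simp add: lattice_N_iff inner_vec2)

lemma lower_support_eqI:
  assumes "\<And>x. x \<in> P \<Longrightarrow> c \<le> u \<bullet> x" "p \<in> P" "u \<bullet> p \<le> c"
  shows "lower_support P u = c"
  unfolding lower_support_def using assms by (intro cInf_eq_minimum) (auto intro: antisym)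

lemma lower_support_le:
  assumes "bounded P" "x \<in> P" shows "lower_support P u \<le> u \<bullet> x"
proof -
  have "bounded ((\<bullet>) u ` P)"
    using assms(1) by (intro bounded_linear_image bounded_linear_inner_right)
  then show ?thesis unfolding lower_support_def
    using assms(2) by (intro cINF_lower bounded_imp_bdd_below)
qed

lemma hull_inner_ge:
  fixes u :: "'a::real_inner"
  assumes "\<And>v. v \<in> V \<Longrightarrow> c \<le> u \<bullet> v" "x \<in> convex hull V"
  shows "c \<le> u \<bullet> x"
proof -
  have "convex hull V \<subseteq> {x. u \<bullet> x \<ge> c}"
    using assms(1) by (intro hull_minimal) (auto simp: convex_halfspace_ge)
  then show ?thesis using assms(2) by auto
qed

text \<open>
  Among the vertices minimising \<open>u\<close>, one that also minimises \<open>v\<close> stays minimal for \<open>u + t v\<close> as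
  long as \<open>t\<close> is small.
\<close>
lemma lower_support_hull_slope:
  assumes V: "finite V" "V \<noteq> {}" and P: "P = convex hull V"
  obtains p where "p \<in> V" "u \<bullet> p = lower_support P u" "slope (lower_support P) u v (v \<bullet> p)"
proof -
  define W where "W = {x \<in> V. \<forall>y\<in>V. u \<bullet> x \<le> u \<bullet> y}"
  have "\<exists>x\<in>V. \<forall>y\<in>V. u \<bullet> x \<le> u \<bullet> y"
    using ex_min_if_finite[of "(\<bullet>) u ` V"] V by (auto simp: not_less) 
  then have W: "finite W" "W \<noteq> {}" using V by (auto simp: W_def)
  then obtain p where p: "p \<in> W" "\<forall>y\<in>W. v \<bullet> p \<le> v \<bullet> y"
    using ex_min_if_finite[of "(\<bullet>) v ` W"] by (auto simp: not_less)
  have pV: "p \<in> V" using p by (simp add: W_def)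
  have attained: "lower_support P x = x \<bullet> p" if "\<forall>y\<in>V. x \<bullet> p \<le> x \<bullet> y" for x
    unfolding P using that pV by (intro lower_support_eqI[of _ _ _ p]) (auto intro: hull_inner_ge hull_inc)
  have up: "lower_support P u = u \<bullet> p" using p by (intro attained) (auto simp: W_def)
  have "\<forall>\<^sub>F t in at_right 0. (u + t *\<^sub>R v) \<bullet> p \<le> (u + t *\<^sub>R v) \<bullet> y" if y: "y \<in> V" for y
  proof (cases "y \<in> W")
    case True
    then have "u \<bullet> p \<le> u \<bullet> y" "v \<bullet> p \<le> v \<bullet> y" using p y pV by (auto simp: W_def)
    then show ?thesis
      by (intro eventually_mono[OF eventually_at_right_less])
        (auto simp: inner_add_left intro!: add_mono mult_left_mono)
  next
    case False
    then have "u \<bullet> y - u \<bullet> p > 0" using p y by (auto simp: W_def not_le)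
    from eventually_keeps_sign[OF this, of "v \<bullet> y - v \<bullet> p"] show ?thesis
      by eventually_elim (simp add: inner_add_left algebra_simps)
  qed
  then have "\<forall>\<^sub>F t in at_right 0. \<forall>y\<in>V. (u + t *\<^sub>R v) \<bullet> p \<le> (u + t *\<^sub>R v) \<bullet> y"
    using V by (intro eventually_ball_finite) auto
  then have "slope (lower_support P) u v (v \<bullet> p)" unfolding slope_def
    by eventually_elim (simp add: attained up inner_add_left)
  then show ?thesis using that pV up by simp
qed

lemma slope_lower_support_le:
  assumes "bounded P" "x \<in> P" "u \<bullet> x = lower_support P u" "slope (lower_support P) u v a"
  shows "a \<le> v \<bullet> x"
proof -
  have "\<forall>\<^sub>F t in at_right (0::real). a \<le> v \<bullet> x"
    using assms(4)[unfolded slope_def] eventually_at_right_less[of "0::real"]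
  proof eventually_elim
    case (elim t)
    have "lower_support P u + t * a \<le> (u + t *\<^sub>R v) \<bullet> x"
      using lower_support_le[OF assms(1,2), of "u + t *\<^sub>R v"] elim by simp
    then have "t * a \<le> t * (v \<bullet> x)" using assms(3) by (simp add: inner_add_left)
    then show ?case using elim by simp
  qed
  then show ?thesis by simp
qed

lemma fano_vertices:
  assumes "fano_polygon P"
  obtains V where "finite V" "V \<noteq> {}" "P = convex hull V" "V = {v. v extreme_point_of P}"
    "V \<subseteq> lattice_N"
proof -
  have P: "polytope P" "0 \<in> P" using assms interior_subset by (auto simp: fano_polygon_def)
  let ?V = "{v. v extreme_point_of P}"
  have "P = convex hull ?V"
    using P by (intro Krein_Milman_Minkowski polytope_imp_compact polytope_imp_convex)
  moreover have "?V \<noteq> {}" using calculation P by (metis convex_hull_empty empty_iff)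
  moreover have "finite ?V" using P
    by (simp add: finite_polyhedron_extreme_points polytope_imp_polyhedron)
  moreover have "?V \<subseteq> lattice_N" using assms by (auto simp: fano_polygon_def primitive_in_def)
  ultimately show ?thesis using that by blast
qed

lemma fano_bounded: "fano_polygon P \<Longrightarrow> bounded P"
  by (simp add: fano_polygon_def polytope_imp_bounded)

lemma fano_convex: "fano_polygon P \<Longrightarrow> convex P"
  by (simp add: fano_polygon_def polytope_imp_convex)

text \<open>
  The origin lies in the interior, so some negative multiple of \<open>u\<close> lies in \<open>P\<close>. This makes the
  height \<open>- lower_support P u\<close> positive.
\<close>
lemma lower_support_neg:
  assumes P: "fano_polygon P" and u: "u \<noteq> 0"
  shows "lower_support P u < 0"
proof -
  obtain e where e: "e > 0" "cball 0 e \<subseteq> P"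
    using P by (meson fano_polygon_def mem_interior_cball)
  define x where "x = - (e / norm u) *\<^sub>R u"
  have "x \<in> P" using e u by (auto simp: x_def intro!: subsetD[OF e(2)])
  moreover have "u \<bullet> x < 0" using e u by (simp add: x_def)
  ultimately show ?thesis using lower_support_le[OF fano_bounded[OF P]] by (meson le_less_trans)
qed

lemma mem_face_iff:
  assumes "fano_polygon P" shows "x \<in> face P w \<longleftrightarrow> x \<in> P \<and> w \<bullet> x = lower_support P w"
proof -
  obtain V where V: "finite V" "V \<noteq> {}" "P = convex hull V" by (rule fano_vertices[OF assms])
  obtain p where p: "p \<in> V" "w \<bullet> p = lower_support P w" using lower_support_hull_slope[OF V] by metis
  then have "p \<in> P" using V by (simp add: hull_inc)
  moreover have "lower_support P w \<le> w \<bullet> y" if "y \<in> P" for y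
    using lower_support_le[OF fano_bounded[OF assms] that] .
  ultimately have "(\<forall>y\<in>P. w \<bullet> x \<le> w \<bullet> y) \<longleftrightarrow> w \<bullet> x = lower_support P w" if "x \<in> P"
    using that by (metis order_antisym p(2) order_refl)
  then show ?thesis by (auto simp: face_def)
qed

lemma pos_homogeneous_lower_support:
  assumes "fano_polygon P" shows "pos_homogeneous (lower_support P)"
  unfolding pos_homogeneous_def
proof (intro allI impI)
  fix c :: real and u assume c: "c > 0"
  obtain V where V: "finite V" "V \<noteq> {}" "P = convex hull V" by (rule fano_vertices[OF assms])
  obtain p where p: "p \<in> V" "u \<bullet> p = lower_support P u" using lower_support_hull_slope[OF V] by metis
  then have "p \<in> P" using V by (simp add: hull_inc)
  with p c show "lower_support P (c *\<^sub>R u) = c * lower_support P u"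
    by (intro lower_support_eqI[of _ _ _ p]) (auto intro!: mult_left_mono lower_support_le fano_bounded assms)
qed

text \<open>
  A compact convex set is the intersection of the half-planes that contain it.
\<close>
lemma lower_support_inject:
  assumes "compact P" "convex P" "P \<noteq> {}" "compact Q" "convex Q" "Q \<noteq> {}" and eq: "lower_support P = lower_support Q"
  shows "P = Q"
proof -
  have sub: "R \<subseteq> S"
    if st: "compact R" "compact S" "convex S" "S \<noteq> {}" "lower_support R = lower_support S" for R S
  proof
    fix x assume x: "x \<in> R"
    show "x \<in> S"
    proof (rule ccontr)
      assume "x \<notin> S"
      then obtain a b where ab: "a \<bullet> x < b" "\<forall>y\<in>S. b < a \<bullet> y"
        using separating_hyperplane_closed_point[OF st(3) compact_imp_closed[OF st(2)] \<open>x \<notin> S\<close>]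
        by metis
      have "b \<le> lower_support S a" unfolding lower_support_def using ab st
        by (intro cINF_greatest) (auto simp: less_imp_le)
      also have "\<dots> \<le> a \<bullet> x" using lower_support_le[of R x a] x st by (simp add: compact_imp_bounded)
      finally show False using ab by simp
    qed
  qed
  show ?thesis using sub[of P Q] sub[of Q P] assms by auto
qed

section \<open>The lower support function of a mutation\<close>

lemma slice_subset:
  assumes "convex P" "x \<in> slice w h P" shows "x \<in> P" "w \<bullet> x = of_int h"
proof -
  have "slice w h P \<subseteq> P \<inter> {x. w \<bullet> x = of_int h}"
    unfolding slice_def using assms(1)
    by (intro hull_minimal) (auto intro: convex_Int convex_hyperplane)
  then show "x \<in> P" "w \<bullet> x = of_int h" using assms(2) by auto
qed

text \<open>
  At height \<open>h\<close>, mutation adds \<open>h\<close> copies of \<open>F\<close> in the Minkowski sense, where negative \<open>h\<close>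
  means removing copies. Minkowski sums add the minima of \<open>u\<close>, so in both cases the minimum over
  the slice changes by \<open>h * k\<close>, where \<open>k\<close> is the minimum of \<open>u\<close> on \<open>F\<close>. On points of height
  \<open>h\<close> this is the value of \<open>k w\<close>. For negative \<open>h\<close> the sum \<open>G h + \<bar>h\<bar> F\<close> may be smaller than
  the slice, but it contains the vertices of \<open>P\<close> at that height, and minima over \<open>P\<close> are attained at
  vertices.
\<close>
lemma lower_support_mut:
  assumes P: "fano_polygon P" and w: "w \<in> lattice_N" and F: "F = convex hull {0, v}"
    and wv: "w \<bullet> v = 0" and G: "mutation_data P w F G"
  shows "lower_support (mut P w F G) u = lower_support P (u + min 0 (u \<bullet> v) *\<^sub>R w)"
proof -
  obtain V where V: "finite V" "V \<noteq> {}" "P = convex hull V" "V = {v. v extreme_point_of P}"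
    "V \<subseteq> lattice_N" by (rule fano_vertices[OF P])
  define k where "k = min 0 (u \<bullet> v)"
  define u' where "u' = u + k *\<^sub>R w"
  \<comment> \<open>\<open>f0\<close> is a point of \<open>F\<close> where \<open>u\<close> takes its minimum \<open>k\<close>.\<close>
  define f0 where "f0 = (if u \<bullet> v < 0 then v else 0)"
  have f0: "f0 \<in> F" "u \<bullet> f0 = k" "w \<bullet> f0 = 0"
    by (auto simp: f0_def k_def F wv hull_inc)
  have kF: "k \<le> u \<bullet> f" if "f \<in> F" for f
    using that unfolding F by (rule hull_inner_ge[rotated]) (auto simp: k_def)
  have u': "u' \<bullet> x = u \<bullet> x + k * (w \<bullet> x)" for x by (simp add: u'_def inner_add_left)
  have supportP: "lower_support P u' \<le> u' \<bullet> x" if "x \<in> P" for x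
    using lower_support_le[OF fano_bounded[OF P] that] .
  obtain p where p: "p \<in> V" "u' \<bullet> p = lower_support P u'" using lower_support_hull_slope[OF V(1-3)] by metis
  have pP: "p \<in> P" using p unfolding V(3) by (simp add: hull_inc)
  obtain h where h: "w \<bullet> p = of_int h"
    using lattice_inner_Ints[OF w] p V(5) by (blast elim: Ints_cases)
  define S where "S = (\<Union>h\<in>{h::int. (INF v\<in>P. w \<bullet> v) \<le> of_int h \<and> h < 0}. G h) \<union>
      (\<Union>h\<in>{h::int. 0 \<le> h \<and> of_int h \<le> (SUP v\<in>P. w \<bullet> v)}.
         slice w h P + (*\<^sub>R) (of_int h) ` F)"
  have mut: "mut P w F G = convex hull S" by (simp add: mut_def S_def)
  have lower: "lower_support P u' \<le> u \<bullet> x" if xS: "x \<in> S" for x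
  proof -
    consider (neg) j where "(INF v\<in>P. w \<bullet> v) \<le> of_int j" "j < 0" "x \<in> G j"
      | (pos) j y f where "0 \<le> j" "y \<in> slice w j P" "f \<in> F" "x = y + of_int j *\<^sub>R f"
      using xS unfolding S_def by (auto elim!: set_plus_elim)
    then show ?thesis
    proof cases
      case neg
      let ?y = "x + of_int \<bar>j\<bar> *\<^sub>R f0"
      have "?y \<in> G j + (*\<^sub>R) (of_int \<bar>j\<bar>) ` F" using neg f0 by (intro set_plus_intro) auto
      then have "?y \<in> slice w j P" using G neg unfolding mutation_data_def by blast
      note y = slice_subset[OF fano_convex[OF P] this]
      have "lower_support P u' \<le> u \<bullet> ?y + k * (w \<bullet> ?y)" using supportP[OF y(1)] u' by simp
      also have "\<dots> = u \<bullet> x" unfolding y(2) using neg f0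
        by (simp add: inner_add_right algebra_simps)
      finally show ?thesis .
    next
      case pos
      note y = slice_subset[OF fano_convex[OF P] pos(2)]
      have "lower_support P u' \<le> u \<bullet> y + k * of_int j" using supportP[OF y(1)] u' y(2) by simp
      also have "\<dots> \<le> u \<bullet> x" using pos kF[OF pos(3)]
        by (simp add: inner_add_right mult.commute[of k] mult_left_mono)
      finally show ?thesis .
    qed
  qed
  have "\<exists>x\<in>S. u \<bullet> x \<le> lower_support P u'"
  proof (cases "h < 0")
    case True
    have *: "(INF v\<in>P. w \<bullet> v) \<le> of_int h"
      using lower_support_le[OF fano_bounded[OF P] pP, of w] h by (simp add: lower_support_def)
    then have "p \<in> G h + (*\<^sub>R) (of_int \<bar>h\<bar>) ` F"
      using G True p V(4) h unfolding mutation_data_def by blast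
    then obtain g f where gf: "g \<in> G h" "f \<in> F" "p = g + of_int \<bar>h\<bar> *\<^sub>R f"
      by (auto elim!: set_plus_elim)
    have gS: "g \<in> S" unfolding S_def using gf * True by auto
    have "of_int \<bar>h\<bar> * k \<le> of_int \<bar>h\<bar> * (u \<bullet> f)"
      using kF[OF gf(2)] by (intro mult_left_mono) auto
    moreover have "u \<bullet> p = u \<bullet> g + of_int \<bar>h\<bar> * (u \<bullet> f)"
      unfolding gf(3) by (simp add: inner_add_right)
    moreover have "of_int \<bar>h\<bar> * k = - (k * of_int h)" using True by simp
    ultimately have "u \<bullet> g \<le> lower_support P u'"
      unfolding p(2)[symmetric] u' h by linarith
    then show ?thesis using gS by blast
  next
    case False
    have "bounded ((\<bullet>) w ` P)"
      using fano_bounded[OF P] by (intro bounded_linear_image bounded_linear_inner_right)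
    then have *: "of_int h \<le> (SUP v\<in>P. w \<bullet> v)"
      unfolding h[symmetric] using pP by (intro cSUP_upper bounded_imp_bdd_above)
    have "p \<in> slice w h P" unfolding slice_def using pP p V(5) h by (intro hull_inc) auto
    then have "p + of_int h *\<^sub>R f0 \<in> slice w h P + (*\<^sub>R) (of_int h) ` F"
      using f0 by (intro set_plus_intro) auto
    then have "p + of_int h *\<^sub>R f0 \<in> S" unfolding S_def using * False by auto
    moreover have "u \<bullet> (p + of_int h *\<^sub>R f0) \<le> lower_support P u'"
      unfolding p(2)[symmetric] u' h using f0 by (simp add: inner_add_right algebra_simps)
    ultimately show ?thesis by blast
  qed
  then obtain x where "x \<in> S" "u \<bullet> x \<le> lower_support P u'" by blast
  then show ?thesis
    unfolding mut k_def[symmetric] u'_def[symmetric]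
    using lower by (intro lower_support_eqI[of _ _ _ x]) (auto intro: hull_inner_ge hull_inc)
qed

section \<open>Edges, heights and widths\<close>

definition rot :: "real^2 \<Rightarrow> real^2" where "rot u = vector [- u $ 2, u $ 1]"

lemma rot_nth [simp]: "rot u $ 1 = - u $ 2" "rot u $ 2 = u $ 1"
  by (simp_all add: rot_def)

text \<open>
  Cramer's rule: it recovers \<open>x\<close> from its pairings with \<open>u\<close> and \<open>v\<close>.
\<close>
lemma cramer: "det2 u v *\<^sub>R x = (v \<bullet> x) *\<^sub>R rot u - (u \<bullet> x) *\<^sub>R rot v"
  by (simp add: vec2_eq_iff inner_vec2 det2_def algebra_simps)

lemma rot_lattice: "u \<in> lattice_N \<Longrightarrow> rot u \<in> lattice_N"
  by (simp add: lattice_N_iff)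

lemma lattice_N_closed:
  "u \<in> lattice_N \<Longrightarrow> v \<in> lattice_N \<Longrightarrow> u + v \<in> lattice_N"
  "u \<in> lattice_N \<Longrightarrow> v \<in> lattice_N \<Longrightarrow> u - v \<in> lattice_N"
  "u \<in> lattice_N \<Longrightarrow> c \<in> \<int> \<Longrightarrow> c *\<^sub>R u \<in> lattice_N"
  by (auto simp: lattice_N_iff)

lemma det2_Ints: "u \<in> lattice_N \<Longrightarrow> v \<in> lattice_N \<Longrightarrow> det2 u v \<in> \<int>"
  by (auto simp: lattice_N_iff det2_def)

lemma primitive_if_det2:
  assumes "u \<in> lattice_N" "v \<in> lattice_N" "\<bar>det2 u v\<bar> = 1"
  shows "primitive_in lattice_N u"
  unfolding primitive_in_def
proof (intro conjI ballI allI impI)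
  show "u \<in> lattice_N" by fact
  show "u \<noteq> 0" using assms(3) by (auto simp: det2_def)
  fix y and k :: int assume y: "y \<in> lattice_N" "u = of_int k *\<^sub>R y"
  obtain d where d: "det2 y v = of_int d" using det2_Ints[OF y(1) assms(2)] by (auto elim: Ints_cases)
  have "det2 u v = of_int k * det2 y v" by (simp add: y det2_def algebra_simps)
  then have "\<bar>real_of_int (k * d)\<bar> = 1" using assms(3) d by simp
  then have "\<bar>k * d\<bar> = 1" by linarith
  then show "\<bar>k\<bar> = 1" by (metis abs_mult abs_zmult_eq_1)
qed

lemma primitive_complement:
  assumes "primitive_in lattice_N u"
  obtains v where "v \<in> lattice_N" "det2 u v = 1"
proof -
  obtain a b :: int where ab: "u $ 1 = of_int a" "u $ 2 = of_int b"
    using assms by (auto simp: primitive_in_def lattice_N_iff elim!: Ints_cases)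
  define g where "g = gcd a b"
  have "u = of_int g *\<^sub>R vector [of_int (a div g), of_int (b div g)]"
    using ab by (simp add: vec2_eq_iff g_def flip: of_int_mult)
  then have "\<bar>g\<bar> = 1"
    using assms unfolding primitive_in_def by (force simp: lattice_N_iff)
  then have "gcd a b = 1" by (simp add: g_def)
  then obtain x y where xy: "x * a + y * b = 1" using bezout_int[of a b] by metis
  show ?thesis
  proof (rule that[of "vector [- of_int y, of_int x]"])
    have "det2 u (vector [- of_int y, of_int x]) = of_int (x * a + y * b)"
      by (simp add: det2_def ab algebra_simps)
    then show "det2 u (vector [- of_int y, of_int x]) = 1" by (simp only: xy of_int_1)
  qed (simp add: lattice_N_iff)
qed

lemma orthogonal_multiple:
  assumes "d \<noteq> 0" "u \<bullet> d = 0" "w \<bullet> d = 0" "det2 u v = 1"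
  shows "w = det2 w v *\<^sub>R u"
proof -
  have "det2 u w *\<^sub>R d = 0" using cramer[of u w d] assms by simp
  then have "det2 u w = 0" using assms by simp
  then show ?thesis using assms(4) by (simp add: vec2_eq_iff det2_def) algebra
qed

lemma primitive_proportional:
  assumes "primitive_in lattice_N u" "primitive_in lattice_N w" "d \<noteq> 0" "u \<bullet> d = 0" "w \<bullet> d = 0"
  shows "w = u \<or> w = - u"
proof -
  obtain v where v: "v \<in> lattice_N" "det2 u v = 1" using primitive_complement assms by metis
  have w: "w = det2 w v *\<^sub>R u" using orthogonal_multiple assms v by metis
  obtain k where "det2 w v = of_int k"
    using det2_Ints v assms by (metis Ints_cases primitive_in_def)
  with w have k: "w = of_int k *\<^sub>R u" by simp
  then have "\<bar>k\<bar> = 1" using assms unfolding primitive_in_def by blast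
  then have "k = 1 \<or> k = - 1" by linarith
  then show ?thesis using k by auto
qed

lemma primitive_orthogonal:
  assumes d: "d \<in> lattice_N" "d \<noteq> 0"
  obtains w where "primitive_in lattice_N w" "w \<bullet> d = 0"
proof -
  obtain m n :: int where mn: "d $ 1 = of_int m" "d $ 2 = of_int n"
    using d by (auto simp: lattice_N_iff elim!: Ints_cases)
  define g where "g = gcd m n"
  have g: "g > 0" using d mn by (auto simp: g_def vec2_eq_iff)
  define w :: "real^2" where "w = vector [- of_int (n div g), of_int (m div g)]"
  have "real_of_int m = of_int g * of_int (m div g)" "real_of_int n = of_int g * of_int (n div g)"
    by (simp_all add: g_def flip: of_int_mult)
  then have dw: "rot d = of_int g *\<^sub>R w" by (simp add: vec2_eq_iff mn w_def)
  have "coprime (m div g) (n div g)"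
    unfolding g_def using d mn by (intro div_gcd_coprime) (auto simp: vec2_eq_iff)
  then obtain x y where xy: "x * (m div g) + y * (n div g) = 1"
    using bezout_int[of "m div g" "n div g"] by (metis coprime_imp_gcd_eq_1)
  have "det2 w (vector [- of_int x, - of_int y]) = of_int (x * (m div g) + y * (n div g))"
    by (simp add: det2_def w_def algebra_simps)
  then have "primitive_in lattice_N w"
    unfolding xy by (intro primitive_if_det2[of _ "vector [- of_int x, - of_int y]"])
      (auto simp: lattice_N_iff w_def)
  moreover have "of_int g * (w \<bullet> d) = rot d \<bullet> d" unfolding dw by simp
  then have "w \<bullet> d = 0" using g by (simp add: inner_vec2)
  ultimately show ?thesis using that by blast
qed

lemma finite_lattice_Int:
  assumes "bounded S" shows "finite (S \<inter> lattice_N)"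
proof -
  obtain B where B: "\<And>x. x \<in> S \<Longrightarrow> norm x \<le> B" using assms bounded_iff by metis
  define I where "I = {- \<lceil>B\<rceil>..\<lceil>B\<rceil>}"
  have "S \<inter> lattice_N \<subseteq> (\<lambda>(a, b). vector [of_int a, of_int b]) ` (I \<times> I)"
  proof
    fix x assume x: "x \<in> S \<inter> lattice_N"
    then obtain a b where ab: "x $ 1 = of_int a" "x $ 2 = of_int b"
      by (auto simp: lattice_N_iff elim!: Ints_cases)
    have "\<bar>x $ 1\<bar> \<le> B" "\<bar>x $ 2\<bar> \<le> B" using x B component_le_norm_cart order_trans by blast+
    then have "a \<in> I" "b \<in> I" unfolding I_def ab by (auto; linarith)+
    moreover have "x = vector [of_int a, of_int b]" using ab by (simp add: vec2_eq_iff)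
    ultimately show "x \<in> (\<lambda>(a, b). vector [of_int a, of_int b]) ` (I \<times> I)" by auto
  qed
  then show ?thesis by (rule finite_subset) (simp add: I_def)
qed

lemma edge_two_vertices:
  assumes P: "fano_polygon P" and E: "E edge_of P"
  obtains p q where "p \<noteq> q" "p \<in> E" "q \<in> E" "p extreme_point_of P" "q extreme_point_of P"
    "p \<in> lattice_N" "q \<in> lattice_N"
proof -
  have face: "E face_of P" "aff_dim E = 1" using E by (auto simp: edge_of_def)
  let ?V = "{v. v extreme_point_of E}"
  have "polytope E" using P face face_of_polytope_polytope by (auto simp: fano_polygon_def)
  then have hull: "E = convex hull ?V"
    by (intro Krein_Milman_Minkowski polytope_imp_compact polytope_imp_convex)
  obtain p where p: "p \<in> ?V"
    using hull face(2) by (metis aff_dim_empty convex_hull_empty equals0I one_neq_neg_one)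
  have "?V \<noteq> {p}" using hull face(2) by (metis aff_dim_sing convex_hull_singleton zero_neq_one)
  then obtain q where q: "q \<in> ?V" "p \<noteq> q" using p by blast
  have V: "x \<in> E \<and> x extreme_point_of P \<and> x \<in> lattice_N" if "x \<in> ?V" for x
    using that P face extreme_point_of_face[OF face(1)]
    by (auto simp: fano_polygon_def primitive_in_def)
  show ?thesis using that[of p q] V p q by blast
qed

text \<open>
  Two primitive normals to the same segment agree up to sign. Opposite signs are impossible, since
  both forms are negative on the face.
\<close>
lemma face_normal_unique:
  assumes P: "fano_polygon P" and pq: "p \<noteq> q" "p \<in> face P w" "q \<in> face P w"
    and w: "primitive_in lattice_N w" "primitive_in lattice_N w'" and eq: "face P w = face P w'"
  shows "w = w'"
proof -
  have h: "w \<bullet> p = lower_support P w" "w \<bullet> q = lower_support P w" "w' \<bullet> p = lower_support P w'" "w' \<bullet> q = lower_support P w'"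
    using pq eq mem_face_iff[OF P] by auto
  then have "w' = w \<or> w' = - w"
    using primitive_proportional[OF w, of "q - p"] pq by (simp add: inner_diff_right)
  moreover have "lower_support P w < 0" "lower_support P w' < 0"
    using lower_support_neg[OF P] w by (auto simp: primitive_in_def)
  ultimately show ?thesis using h by auto
qed

text \<open>
  Edges of a polytope are exposed by some linear form, and an edge contains two distinct lattice
  points, so that the form is proportional to a primitive lattice vector. This and
  \<open>face_normal_unique\<close> show that the definite description in \<open>inner_normal\<close> denotes.
\<close>
lemma edge_inner_normal:
  assumes P: "fano_polygon P" and E: "E edge_of P"
  shows "primitive_in lattice_N (inner_normal P E)" "E = face P (inner_normal P E)"
proof -
  obtain p q where pq: "p \<noteq> q" "p \<in> E" "q \<in> E" "p \<in> lattice_N" "q \<in> lattice_N"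
    by (rule edge_two_vertices[OF P E])
  have "E face_of P" using E by (simp add: edge_of_def)
  then have "E exposed_face_of P"
    using P by (simp add: fano_polygon_def polytope_imp_polyhedron exposed_face_of_polyhedron)
  then obtain a b where ab: "P \<subseteq> {x. a \<bullet> x \<le> b}" "E = P \<inter> {x. a \<bullet> x = b}"
    by (auto simp: exposed_face_of_def)
  have "a \<noteq> 0"
  proof
    assume "a = 0"
    then have "E = P" using ab pq by auto
    then have "aff_dim P = 1" using E by (simp add: edge_of_def)
    moreover have "aff_dim P = 2"
      using P aff_dim_nonempty_interior[of P] by (auto simp: fano_polygon_def)
    ultimately show False by simp
  qed
  have "\<exists>w. primitive_in lattice_N w \<and> E = face P w"
  proof -
    define d where "d = q - p"
    have d: "d \<in> lattice_N" "d \<noteq> 0" "a \<bullet> d = 0"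
      using pq ab by (auto simp: d_def lattice_N_closed inner_diff_right)
    obtain w where w: "primitive_in lattice_N w" "w \<bullet> d = 0" using primitive_orthogonal d by metis
    obtain v where v: "v \<in> lattice_N" "det2 w v = 1" using primitive_complement w by metis
    have a: "a = det2 a v *\<^sub>R w" using orthogonal_multiple d w v by metis
    define t where "t = det2 a v"
    have at: "a = t *\<^sub>R w" using a by (simp add: t_def)
    have "t \<noteq> 0" using at \<open>a \<noteq> 0\<close> by auto
    \<comment> \<open>\<open>a\<close> is maximal on \<open>E\<close>, whereas an inner normal is minimal there.\<close>
    define w' where "w' = (if t > 0 then - w else w)"
    have a': "a = (- \<bar>t\<bar>) *\<^sub>R w'" using at by (simp add: w'_def)
    have "primitive_in lattice_N w'"
      using w v primitive_if_det2[of "- w" v]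
      by (auto simp: w'_def primitive_in_def det2_def lattice_N_iff)
    moreover have "E = face P w'"
    proof -
      have le: "w' \<bullet> x \<le> w' \<bullet> y \<longleftrightarrow> a \<bullet> y \<le> a \<bullet> x" for x y
        using \<open>t \<noteq> 0\<close> unfolding a' by simp
      show ?thesis unfolding face_def le using ab pq by (auto intro: antisym)
    qed
    ultimately show ?thesis by blast
  qed
  moreover have "w = w'"
    if "primitive_in lattice_N w" "E = face P w" "primitive_in lattice_N w'" "E = face P w'" for w w'
    using face_normal_unique[OF P pq(1)] that pq by metis
  ultimately have "\<exists>!w. primitive_in lattice_N w \<and> E = face P w" by blast
  from theI'[OF this] show "primitive_in lattice_N (inner_normal P E)" "E = face P (inner_normal P E)"
    by (auto simp: inner_normal_def lattice_M_eq face_def)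
qed

lemma inner_normal_eqI:
  assumes P: "fano_polygon P" and E: "E edge_of P" and w: "primitive_in lattice_N w" "E = face P w"
  shows "inner_normal P E = w"
proof -
  obtain p q where "p \<noteq> q" "p \<in> E" "q \<in> E" by (rule edge_two_vertices[OF P E])
  then show ?thesis using face_normal_unique[OF P] edge_inner_normal[OF P E] w by metis
qed

text \<open>
  The two slopes are attained at vertices \<open>p\<close> and \<open>q\<close> of the face, and \<open>q = p + n t\<close> with \<open>t\<close>
  the lattice vector orthogonal to \<open>u\<close> that pairs to 1 with \<open>v\<close>. For positive \<open>n\<close> the face
  contains the lattice points \<open>p, p + t, ..., p + n t\<close>.
\<close>
lemma kink_le_width:
  assumes P: "fano_polygon P" and u: "u \<in> lattice_N" and v: "v \<in> lattice_N" and d: "\<bar>det2 u v\<bar> = 1"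
    and a: "slope (lower_support P) u v a" and b: "slope (lower_support P) u (- v) b"
  shows "- a - b \<le> lattice_width (face P u)"
    and "- a - b > 0 \<Longrightarrow> face P u edge_of P"
proof -
  obtain V where V: "finite V" "V \<noteq> {}" "P = convex hull V" "V \<subseteq> lattice_N"
    by (rule fano_vertices[OF P])
  obtain p where p: "p \<in> V" "u \<bullet> p = lower_support P u" "slope (lower_support P) u v (v \<bullet> p)"
    using lower_support_hull_slope[OF V(1-3)] by metis
  obtain q where q: "q \<in> V" "u \<bullet> q = lower_support P u" "slope (lower_support P) u (- v) ((- v) \<bullet> q)"
    using lower_support_hull_slope[OF V(1-3)] by metis
  have ab: "a = v \<bullet> p" "b = - (v \<bullet> q)" using slope_unique p(3) q(3) a b by fastforce+
  have "p \<in> P" "q \<in> P" unfolding V(3) using p q by (simp_all add: hull_inc)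
  then have pqE: "p \<in> face P u" "q \<in> face P u" using p q by (simp_all add: mem_face_iff[OF P])
  have N: "p \<in> lattice_N" "q \<in> lattice_N" using p q V by auto
  define t where "t = det2 u v *\<^sub>R rot u"
  have dd: "det2 u v * det2 u v = 1" using d by (metis abs_mult_self_eq mult_1)
  have tN: "t \<in> lattice_N" unfolding t_def using u v by (intro lattice_N_closed rot_lattice det2_Ints)
  have t0: "t \<noteq> 0" using d by (auto simp: t_def vec2_eq_iff det2_def)
  obtain n where n: "v \<bullet> (q - p) = of_int n"
    using lattice_inner_Ints[OF v] N lattice_N_closed(2) by (metis Ints_cases)
  have kink: "- a - b = of_int n" using n by (simp add: ab inner_diff_right)
  have qp: "q = p + of_int n *\<^sub>R t"
  proof -
    have "u \<bullet> (q - p) = 0" using p q by (simp add: inner_diff_right)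
    then have "det2 u v *\<^sub>R (q - p) = of_int n *\<^sub>R rot u" using cramer[of u v "q - p"] n by simp
    then have "(det2 u v * det2 u v) *\<^sub>R (q - p) = of_int n *\<^sub>R t"
      by (simp add: t_def flip: scaleR_scaleR) (simp add: mult.commute)
    then have "q - p = of_int n *\<^sub>R t" by (simp add: dd)
    then show ?thesis by (metis add.commute diff_add_cancel)
  qed
  have cE: "face P u face_of P"
  proof -
    have "face P u = P \<inter> {x. u \<bullet> x = lower_support P u}" using mem_face_iff[OF P] by blast
    then show ?thesis
      using face_of_Int_supporting_hyperplane_ge[OF fano_convex[OF P]] lower_support_le[OF fano_bounded[OF P]]
      by simp
  qed
  show "- a - b \<le> lattice_width (face P u)"
  proof (cases "n > 0")
    case True
    define g where "g = (\<lambda>i::nat. p + real i *\<^sub>R t)"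
    have "g ` {..nat n} \<subseteq> face P u \<inter> lattice_N"
    proof
      fix x assume "x \<in> g ` {..nat n}"
      then obtain i where i: "i \<le> nat n" "x = p + real i *\<^sub>R t" by (auto simp: g_def)
      have "x = (1 - real i / of_int n) *\<^sub>R p + (real i / of_int n) *\<^sub>R q"
        using True by (simp add: i qp algebra_simps)
      moreover have "real i / of_int n \<le> 1" using i True by simp
      ultimately have "x \<in> face P u"
        using face_of_imp_convex[OF cE] pqE True by (auto simp: convex_alt)
      then show "x \<in> face P u \<inter> lattice_N" using N tN i by (simp add: lattice_N_closed)
    qed
    moreover have "finite (face P u \<inter> lattice_N)"
      by (rule finite_lattice_Int[OF bounded_subset[OF fano_bounded[OF P] face_of_imp_subset[OF cE]]])
    moreover have "inj_on g {..nat n}" using t0 by (auto simp: inj_on_def g_def)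
    ultimately have "nat n + 1 \<le> card (face P u \<inter> lattice_N)"
      using card_mono card_image by (metis Suc_eq_plus1 card_atMost)
    then have "nat n \<le> lattice_width (face P u)" by (simp add: lattice_width_def)
    then show ?thesis unfolding kink by linarith
  qed (simp add: kink)
  assume "- a - b > 0"
  then have "n \<noteq> 0" by (simp add: kink)
  then have pq: "p \<noteq> q" using qp t0 by simp
  have "u \<noteq> 0" using d by (auto simp: det2_def)
  have "face P u \<subseteq> {x. u \<bullet> x = lower_support P u}" using mem_face_iff[OF P] by blast
  then have "aff_dim (face P u) \<le> aff_dim {x. u \<bullet> x = lower_support P u}" by (rule aff_dim_subset)
  also have "\<dots> = 1" using \<open>u \<noteq> 0\<close> by simp
  finally have "aff_dim (face P u) \<le> 1" .
  moreover have "aff_dim {p, q} \<le> aff_dim (face P u)" using pqE by (intro aff_dim_subset) auto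
  then have "1 \<le> aff_dim (face P u)" using pq by simp
  ultimately show "face P u edge_of P" using cE by (simp add: edge_of_def)
qed

lemma edge_height_eq:
  assumes P: "fano_polygon P" and E: "E edge_of P"
  shows "real (edge_height P E) = - lower_support P (inner_normal P E)"
proof -
  obtain p q where pq: "p \<in> E" "p \<in> lattice_N" by (rule edge_two_vertices[OF P E])
  define w where "w = inner_normal P E"
  note w = edge_inner_normal[OF P E, folded w_def]
  have h: "w \<bullet> x = lower_support P w" if "x \<in> E" for x using that w mem_face_iff[OF P] by blast
  obtain k where k: "w \<bullet> p = of_int k"
    using lattice_inner_Ints[of w p] pq w by (auto simp: primitive_in_def elim: Ints_cases)
  have "lower_support P w < 0" using lower_support_neg[OF P] w by (auto simp: primitive_in_def)
  then have r: "lower_support P w = - real (nat (- k))" using h pq k by auto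
  have "edge_height P E = nat (- k)"
    unfolding edge_height_def w_def[symmetric] using h pq r by (intro the_equality) fastforce+
  then show ?thesis using r by (simp add: w_def)
qed

text \<open>
  At the lowest height \<open>h\<close> the slice lies in the edge \<open>E\<close>, and \<open>G h\<close> is nonempty because \<open>E\<close> has
  vertices. So \<open>E\<close> contains a translate of \<open>\<bar>h\<bar> F\<close>: only edges with at least one
  primitive T-cone can be mutated.
\<close>
lemma mutation_kink:
  assumes P: "fano_polygon P" and E: "E edge_of P" and w: "w = inner_normal P E"
    and v: "primitive_in lattice_N v" "w \<bullet> v = 0" and F: "F = convex hull {0, v}"
    and G: "mutation_data P w F G"
    and y: "y \<in> lattice_N" "\<bar>det2 w y\<bar> = 1"
    and a: "slope (lower_support P) w y a" and b: "slope (lower_support P) w (- y) b"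
  shows "- a - b \<ge> - lower_support P w"
proof -
  obtain p where p: "p \<in> E" "p extreme_point_of P" "p \<in> lattice_N" by (rule edge_two_vertices[OF P E])
  note wE = edge_inner_normal[OF P E, folded w]
  have wp: "w \<bullet> p = lower_support P w" using p wE mem_face_iff[OF P] by blast
  obtain h where h: "lower_support P w = of_int h"
    using lattice_inner_Ints[of w p] p wE wp by (auto simp: primitive_in_def elim: Ints_cases)
  have neg: "h < 0" using lower_support_neg[OF P, of w] wE h by (auto simp: primitive_in_def)
  have data: "{v. v extreme_point_of P \<and> w \<bullet> v = of_int h} \<subseteq> G h + (*\<^sub>R) (of_int \<bar>h\<bar>) ` F"
    "G h + (*\<^sub>R) (of_int \<bar>h\<bar>) ` F \<subseteq> slice w h P"
    using G neg h unfolding mutation_data_def lower_support_def by auto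
  then have "p \<in> G h + (*\<^sub>R) (of_int \<bar>h\<bar>) ` F" using p wp h by auto
  then obtain g where g: "g \<in> G h" by (auto elim!: set_plus_elim)
  have "g + of_int \<bar>h\<bar> *\<^sub>R f \<in> slice w h P" if "f \<in> F" for f
    using data(2) g that by (blast intro: set_plus_intro)
  then have sl: "g + of_int \<bar>h\<bar> *\<^sub>R f \<in> P \<and> w \<bullet> (g + of_int \<bar>h\<bar> *\<^sub>R f) = lower_support P w" if "f \<in> F" for f
    using that slice_subset[OF fano_convex[OF P]] h by metis
  define g' where "g' = g + of_int \<bar>h\<bar> *\<^sub>R v"
  have gg: "g \<in> P" "w \<bullet> g = lower_support P w" "g' \<in> P" "w \<bullet> g' = lower_support P w"
    using sl[of 0] sl[of v] by (auto simp: F hull_inc g'_def)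
  note le = slope_lower_support_le[OF fano_bounded[OF P]]
  have "a \<le> y \<bullet> g" "a \<le> y \<bullet> g'" "b \<le> - (y \<bullet> g)" "b \<le> - (y \<bullet> g')"
    using le[OF gg(1,2) a] le[OF gg(3,4) a] le[OF gg(1,2) b] le[OF gg(3,4) b] by auto
  then have "\<bar>y \<bullet> g' - y \<bullet> g\<bar> \<le> - a - b" by linarith
  moreover have "y \<bullet> g' - y \<bullet> g = of_int \<bar>h\<bar> * (y \<bullet> v)" by (simp add: g'_def inner_add_right)
  moreover have yv: "\<bar>y \<bullet> v\<bar> \<ge> 1"
  proof -
    have "y \<bullet> v \<noteq> 0" using cramer[of w y v] v y by (auto simp: primitive_in_def)
    moreover have "y \<bullet> v \<in> \<int>" using lattice_inner_Ints y v by (auto simp: primitive_in_def)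
    ultimately show ?thesis by (rule Ints_nonzero_abs_ge1[rotated])
  qed
  then have "of_int \<bar>h\<bar> * 1 \<le> of_int \<bar>h\<bar> * \<bar>y \<bullet> v\<bar>" by (intro mult_left_mono) auto
  then have "- lower_support P w \<le> of_int \<bar>h\<bar> * \<bar>y \<bullet> v\<bar>" using neg h by simp
  ultimately show ?thesis by (simp add: abs_mult)
qed

section \<open>Unimodular matrices\<close>

lemma matrix_vector_nth_2 [simp]: "(A *v x) $ i = A $ i $ 1 * x $ 1 + A $ i $ 2 * x $ 2" for A :: "real^2^'n"
  by (simp add: matrix_vector_mult_def sum_2)

lemma GL2Z_iff:
  "A \<in> GL2Z \<longleftrightarrow>
     A $ 1 $ 1 \<in> \<int> \<and> A $ 1 $ 2 \<in> \<int> \<and> A $ 2 $ 1 \<in> \<int> \<and> A $ 2 $ 2 \<in> \<int> \<and> \<bar>det A\<bar> = 1"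
  by (auto simp: GL2Z_def forall_2)

lemma GL2Z_lattice: "A \<in> GL2Z \<Longrightarrow> x \<in> lattice_N \<Longrightarrow> A *v x \<in> lattice_N"
  by (simp add: GL2Z_iff lattice_N_iff)

lemma det2_mult: "det2 (A *v u) (A *v v) = det A * det2 u v"
  by (simp add: det2_def det_2 algebra_simps)

lemma GL2Z_mult: "A \<in> GL2Z \<Longrightarrow> B \<in> GL2Z \<Longrightarrow> A ** B \<in> GL2Z"
  by (simp add: GL2Z_iff det_mul abs_mult) (simp add: matrix_matrix_mult_def sum_2)

lemma GL2Z_transpose: "A \<in> GL2Z \<Longrightarrow> transpose A \<in> GL2Z"
  by (simp add: GL2Z_iff det_transpose) (simp add: transpose_def)

lemma GL2Z_inverse:
  assumes "A \<in> GL2Z"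
  obtains B where "B \<in> GL2Z" "\<And>x. A *v (B *v x) = x" "\<And>x. B *v (A *v x) = x"
proof -
  define d where "d = det A"
  have "\<bar>d\<bar> = 1" using assms by (simp add: GL2Z_iff d_def)
  then have dd: "d * d = 1" by (metis abs_mult_self_eq mult_1)
  define B :: "real^2^2" where
    "B = vector [vector [d * A $ 2 $ 2, - d * A $ 1 $ 2], vector [- d * A $ 2 $ 1, d * A $ 1 $ 1]]"
  have d: "d = A $ 1 $ 1 * A $ 2 $ 2 - A $ 1 $ 2 * A $ 2 $ 1" by (simp add: d_def det_2)
  have "d \<in> \<int>" using assms by (simp add: d GL2Z_iff)
  have "det B = d * d * d" by (simp add: B_def det_2 d algebra_simps)
  then have "B \<in> GL2Z"
    using assms \<open>d \<in> \<int>\<close> \<open>\<bar>d\<bar> = 1\<close> dd by (simp add: GL2Z_iff) (simp add: B_def)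
  moreover have "A *v (B *v x) = (d * d) *\<^sub>R x" "B *v (A *v x) = (d * d) *\<^sub>R x" for x
    unfolding vec2_eq_iff by (simp_all add: B_def) (simp_all add: d algebra_simps)
  ultimately show ?thesis using that dd by simp
qed

lemma inner_matrix_transpose: "u \<bullet> (A *v x) = (transpose A *v u) \<bullet> x" for u x :: "real^2"
  by (simp add: inner_vec2 transpose_def algebra_simps)

lemma lower_support_image: "lower_support ((*v) A ` P) u = lower_support P (transpose A *v u)"
  by (simp add: lower_support_def image_image inner_matrix_transpose)

lemma gl2_equivalent_sym: "gl2_equivalent P Q \<Longrightarrow> gl2_equivalent Q P"
  unfolding gl2_equivalent_def
proof (elim bexE)
  fix A assume "A \<in> GL2Z" and Q: "Q = (*v) A ` P"
  then obtain B where B: "B \<in> GL2Z" "\<And>x. B *v (A *v x) = x" using GL2Z_inverse by metis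
  then have "P = (*v) B ` Q" by (simp add: Q image_image)
  then show "\<exists>B\<in>GL2Z. P = (*v) B ` Q" using B by blast
qed

lemma gl2_equivalent_trans: "gl2_equivalent P Q \<Longrightarrow> gl2_equivalent Q R \<Longrightarrow> gl2_equivalent P R"
  unfolding gl2_equivalent_def
proof (elim bexE)
  fix A B assume "A \<in> GL2Z" "B \<in> GL2Z" "Q = (*v) A ` P" "R = (*v) B ` Q"
  then show "\<exists>A\<in>GL2Z. R = (*v) A ` P"
    by (intro bexI[of _ "B ** A"]) (simp_all add: image_image matrix_vector_mul_assoc GL2Z_mult)
qed

lemma gl2_equivalent_if_lower_support_eq:
  assumes P: "fano_polygon P" and Q: "fano_polygon Q" and A: "A \<in> GL2Z" and B: "B \<in> GL2Z"
    and eq: "\<And>z. lower_support P (A *v z) = lower_support Q (B *v z)"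
  shows "gl2_equivalent P Q"
proof -
  obtain B' where B': "B' \<in> GL2Z" "\<And>x. B *v (B' *v x) = x" using GL2Z_inverse[OF B] by metis
  define C where "C = transpose (A ** B')"
  have C: "C \<in> GL2Z" by (simp add: C_def GL2Z_transpose GL2Z_mult A B')
  have "lower_support ((*v) C ` P) u = lower_support Q u" for u
    using eq[of "B' *v u"]
    by (simp only: lower_support_image C_def transpose_transpose B' flip: matrix_vector_mul_assoc)
  moreover have "polytope ((*v) C ` P)" "polytope Q"
    using P Q by (auto simp: fano_polygon_def intro: polytope_linear_image)
  moreover have "P \<noteq> {}" "Q \<noteq> {}"
    using P Q by (auto simp: fano_polygon_def)
  ultimately have "(*v) C ` P = Q"
    by (intro lower_support_inject) (auto intro: polytope_imp_compact polytope_imp_convex)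
  then show ?thesis using C by (auto simp: gl2_equivalent_def)
qed

text \<open>
  Expressing the standard basis through \<open>u\<close> and \<open>v\<close> with integer coefficients makes
  \<open>det2 u v\<close> a unit of the integers.
\<close>
lemma GL2Z_of_basis:
  assumes "lattice_basis lattice_N u v"
  obtains A where "A \<in> GL2Z" "A *v axis 1 1 = u" "A *v axis 2 1 = v"
proof -
  have uv: "u \<in> lattice_N" "v \<in> lattice_N" using assms by (auto simp: lattice_basis_def)
  have span: "\<exists>c :: int \<times> int. w = of_int (fst c) *\<^sub>R u + of_int (snd c) *\<^sub>R v" if "w \<in> lattice_N" for w
    using assms that unfolding lattice_basis_def by blast
  have "axis 1 1 \<in> lattice_N" "axis 2 1 \<in> lattice_N" by (simp_all add: lattice_N_iff)
  then obtain c c' :: "int \<times> int" where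
    c: "axis 1 1 = of_int (fst c) *\<^sub>R u + of_int (snd c) *\<^sub>R v"
       "axis 2 1 = of_int (fst c') *\<^sub>R u + of_int (snd c') *\<^sub>R v" using span by meson
  obtain d where d: "det2 u v = of_int d" using det2_Ints uv by (metis Ints_cases)
  have "1 = det2 (axis 1 1) (axis 2 1)" by (simp add: det2_def)
  also have "\<dots> = of_int ((fst c * snd c' - snd c * fst c') * d)"
    unfolding c by (simp flip: d) (simp add: det2_def algebra_simps)
  finally have "(fst c * snd c' - snd c * fst c') * d = 1" by linarith
  then have "\<bar>d\<bar> = 1" by (metis abs_zmult_eq_1 abs_one mult.commute)
  then have "\<bar>det2 u v\<bar> = 1" using d by simp
  then show ?thesis
    using uv that[of "vector [vector [u $ 1, v $ 1], vector [u $ 2, v $ 2]]"]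
    by (simp add: GL2Z_iff lattice_N_iff vec2_eq_iff det_2 det2_def algebra_simps)
qed

section \<open>Mutations of an A2 pattern\<close>

lemma slope_linear: "slope (\<lambda>z. f (A *v z)) u v a \<longleftrightarrow> slope f (A *v u) (A *v v) a"
  by (simp add: slope_def matrix_vector_right_distrib matrix_vector_mult_scaleR)

lemma matrix_vector_minus: "A *v (- v) = - (A *v v)" for A :: "real^2^2"
  by (simp add: vec2_eq_iff)

lemma GL2Z_axis_neq: "A \<in> GL2Z \<Longrightarrow> A *v axis 1 1 \<noteq> A *v axis 2 1"
  by (auto simp: vec2_eq_iff GL2Z_iff det_2)

lemma A2_pattern_lower_support:
  assumes P: "fano_polygon P" and T: "T_cone_edges P = {#E1, E2#}"
    and A: "A \<in> GL2Z" "A *v axis 1 1 = inner_normal P E1" "A *v axis 2 1 = inner_normal P E2"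
  shows "A2_pattern (\<lambda>z. lower_support P (A *v z))"
  unfolding A2_pattern_def slope_linear
proof (intro ballI allI impI, elim conjE)
  fix u v a b
  assume u: "u \<in> lattice_N" and v: "v \<in> lattice_N" and d: "det2 u v = 1"
    and a: "slope (lower_support P) (A *v u) (A *v v) a" and b: "slope (lower_support P) (A *v u) (A *v (- v)) b"
  define w y E where "w = A *v u" and "y = A *v v" and "E = face P w"
  have wy: "w \<in> lattice_N" "y \<in> lattice_N" "\<bar>det2 w y\<bar> = 1"
    using u v d A by (auto simp: w_def y_def GL2Z_lattice det2_mult GL2Z_iff)
  have prim: "primitive_in lattice_N w" using primitive_if_det2 wy by blast
  have neg: "lower_support P w < 0" using lower_support_neg[OF P] prim by (auto simp: primitive_in_def)
  have ab: "slope (lower_support P) w y a" "slope (lower_support P) w (- y) b"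
    using a b by (simp_all add: w_def y_def matrix_vector_minus)
  note kink = kink_le_width[OF P wy ab, folded E_def]
  have inj: "x = z" if "A *v x = A *v z" for x z using GL2Z_inverse[OF A(1)] that by metis
  have neq: "E1 \<noteq> E2" using A GL2Z_axis_neq by metis
  have "- a - b < real c * - lower_support P w"
    if c: "c \<ge> 1" and T': "E edge_of P \<Longrightarrow> T_count P E < c" for c
  proof (rule ccontr)
    assume "\<not> ?thesis"
    then have big: "real c * - lower_support P w \<le> - a - b" by simp
    moreover have "real c * - lower_support P w > 0" using c neg by (simp add: mult_pos_neg)
    ultimately have E: "E edge_of P" using kink by linarith
    have "inner_normal P E = w" using inner_normal_eqI[OF P E prim] by (simp add: E_def)
    then have r: "real (edge_height P E) = - lower_support P w" using edge_height_eq[OF P E] by simp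
    then have "real (c * edge_height P E) \<le> real (lattice_width E)" using big kink(1) by simp
    then have "c * edge_height P E \<le> lattice_width E" by linarith
    moreover have "edge_height P E > 0" using r neg by linarith
    ultimately have "c \<le> T_count P E" by (simp add: T_count_def less_eq_div_iff_mult_less_eq)
    then show False using T'[OF E] by simp
  qed
  note bound = this
  have finite: "finite {E. E edge_of P}" using T by (auto simp: T_cone_edges_def intro: ccontr)
  have count: "T_count P E = count {#E1, E2#} E" if "E edge_of P"
  proof -
    have "count (T_cone_edges P) E = (\<Sum>E' | E' edge_of P. if E' = E then T_count P E' else 0)"
      by (auto simp: T_cone_edges_def count_sum intro!: sum.cong)
    also have "\<dots> = T_count P E" using that finite by (simp add: sum.delta)
    finally show ?thesis by (simp add: T)
  qed
  show "- a - b < (if u = axis 1 1 \<or> u = axis 2 1 then 2 else 1) * - lower_support P (A *v u)"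
  proof (cases "u = axis 1 1 \<or> u = axis 2 1")
    case True
    have "- a - b < real 2 * - lower_support P w" by (rule bound) (use count neq in auto)
    then show ?thesis using True by (simp add: w_def)
  next
    case False
    have "E \<noteq> E1 \<and> E \<noteq> E2" if "E edge_of P"
      using inner_normal_eqI[OF P that prim] False inj A by (auto simp: E_def w_def)
    then have "- a - b < real 1 * - lower_support P w" by (intro bound) (use count in auto)
    then show ?thesis using False by (simp add: w_def)
  qed
qed

text \<open>
  The vector \<open>v\<close> is determined by \<open>A\<close> up to sign, so in the coordinates given by \<open>A\<close> the
  change of support function is composition with one of the shears
  \<open>(a, b) \<mapsto> (a + min 0 (\<plusminus> b), b)\<close>. Each of them differs from \<open>pent\<close> by a unimodular
  matrix \<open>J\<close> acting first.
\<close>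
lemma lower_support_reflect:
  assumes A: "A \<in> GL2Z" and v: "primitive_in lattice_N v" "(A *v axis 1 1) \<bullet> v = 0"
    and support: "\<And>u. lower_support Q u = lower_support P (u + min 0 (u \<bullet> v) *\<^sub>R (A *v axis 1 1))"
  shows "\<exists>B\<in>GL2Z. \<forall>z. lower_support Q (B *v z) = lower_support P (A *v pent z)"
proof -
  define x where "x = transpose A *v v"
  have Ax: "(A *v z) \<bullet> v = z \<bullet> x" for z
    unfolding x_def inner_commute[of z] inner_matrix_transpose[symmetric] by (rule inner_commute)
  have x1: "x $ 1 = 0" using v(2) unfolding Ax by (simp add: inner_vec2)
  have "v \<in> lattice_N" using v by (simp add: primitive_in_def)
  then have "x \<in> lattice_N" unfolding x_def by (intro GL2Z_lattice GL2Z_transpose A)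
  then obtain k where k: "x $ 2 = of_int k" by (auto simp: lattice_N_iff elim: Ints_cases)
  obtain B where B: "B \<in> GL2Z" "\<And>x. B *v (transpose A *v x) = x"
    using GL2Z_inverse[OF GL2Z_transpose[OF A]] by metis
  have "x = of_int k *\<^sub>R axis 2 1" using x1 k by (simp add: vec2_eq_iff)
  then have "v = of_int k *\<^sub>R (B *v axis 2 1)" using B(2)[of v] unfolding x_def
    by (simp add: matrix_vector_mult_scaleR)
  moreover have "B *v axis 2 1 \<in> lattice_N" by (intro GL2Z_lattice B) (simp add: lattice_N_iff)
  ultimately have "\<bar>k\<bar> = 1" using v(1) unfolding primitive_in_def by blast
  have support': "lower_support Q (A *v z) = lower_support P (A *v (z + min 0 (z $ 2 * of_int k) *\<^sub>R axis 1 1))" for z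
    unfolding support Ax
    by (simp add: inner_vec2 x1 k matrix_vector_right_distrib matrix_vector_mult_scaleR)
  from \<open>\<bar>k\<bar> = 1\<close> consider "k = 1" | "k = - 1" by linarith
  then obtain J where J: "J \<in> GL2Z"
    "\<And>z. J *v z + min 0 ((J *v z) $ 2 * of_int k) *\<^sub>R axis 1 1 = pent z"
  proof cases
    case 1
    then show ?thesis
      by (intro that[of "vector [vector [0, - 1], vector [1, 0]]"])
        (simp_all add: GL2Z_iff det_2 vec2_eq_iff)
  next
    case 2
    then show ?thesis
      by (intro that[of "vector [vector [1, - 1], vector [1, 0]]"])
        (auto simp: GL2Z_iff det_2 vec2_eq_iff min_def)
  qed
  have "lower_support Q ((A ** J) *v z) = lower_support P (A *v pent z)" for z
    using support'[of "J *v z"] by (simp only: J matrix_vector_mul_assoc)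
  then show ?thesis using A J GL2Z_mult by blast
qed

text \<open>
  The edge that is mutated has width at least its height, so in an A2 pattern its normal is one of
  the two basis directions. In the first direction the mutation acts as \<open>pent\<close>. The second is
  reduced to the first by the swap \<open>S\<close> of the coordinates; \<open>S\<close> conjugates \<open>pent\<close> to
  its inverse, which is the fourth power.
\<close>
lemma mutation_step:
  assumes mut: "is_mutation P Q" and A: "A \<in> GL2Z"
    and support: "\<And>z. lower_support P (A *v z) = f z" and f: "A2_pattern f"
  shows "\<exists>B\<in>GL2Z. \<exists>k\<in>{1, 4}. \<forall>z. lower_support Q (B *v z) = f ((pent ^^ k) z)"
proof -
  obtain E w v F G where P: "fano_polygon P" and E: "E edge_of P" and w: "w = inner_normal P E"
    and v: "primitive_in lattice_N v" "w \<bullet> v = 0" and F: "F = convex hull {0, v}"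
    and G: "mutation_data P w F G" and Q: "Q = mut P w F G"
    using mut unfolding is_mutation_def by blast
  have prim: "primitive_in lattice_N w" using edge_inner_normal[OF P E] w by simp
  then have wN: "w \<in> lattice_N" by (simp add: primitive_in_def)
  have supportQ: "lower_support Q u = lower_support P (u + min 0 (u \<bullet> v) *\<^sub>R w)" for u
    unfolding Q by (rule lower_support_mut[OF P wN F v(2) G])
  obtain A' where A': "A' \<in> GL2Z" "\<And>x. A *v (A' *v x) = x" "\<And>x. A' *v (A *v x) = x"
    using GL2Z_inverse[OF A] by metis
  obtain y where y: "y \<in> lattice_N" "det2 w y = 1" using primitive_complement[OF prim] .
  define u where "u = A' *v w"
  have "u \<in> lattice_N" "A' *v y \<in> lattice_N" using A' wN y by (auto simp: u_def GL2Z_lattice)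
  moreover have "\<bar>det2 u (A' *v y)\<bar> = 1" using A' y by (simp add: u_def det2_mult GL2Z_iff)
  ultimately obtain x where ux: "u \<in> lattice_N" "x \<in> lattice_N" and dux: "det2 u x = 1"
    using primitive_if_det2 primitive_complement by metis
  have Au: "A *v u = w" by (simp add: u_def A')
  obtain V where V: "finite V" "V \<noteq> {}" "P = convex hull V" by (rule fano_vertices[OF P])
  obtain a b where ab: "slope (lower_support P) w (A *v x) a" "slope (lower_support P) w (- (A *v x)) b"
    using lower_support_hull_slope[OF V] by metis
  have f': "f = (\<lambda>z. lower_support P (A *v z))" using support by auto
  have "slope f u x a" "slope f u (- x) b"
    using ab by (simp_all add: f' slope_linear Au matrix_vector_minus)
  then have "- a - b < (if u = axis 1 1 \<or> u = axis 2 1 then 2 else 1) * - f u"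
    using f ux dux unfolding A2_pattern_def by blast
  moreover have "- a - b \<ge> - f u"
  proof -
    have "\<bar>det2 w (A *v x)\<bar> = 1"
      unfolding Au[symmetric] det2_mult using dux A by (simp add: GL2Z_iff)
    from mutation_kink[OF P E w v F G GL2Z_lattice[OF A ux(2)] this ab]
    show ?thesis using support[of u] Au by simp
  qed
  ultimately have "u = axis 1 1 \<or> u = axis 2 1" by (auto split: if_splits)
  then consider (first) "w = A *v axis 1 1" | (second) "w = A *v axis 2 1" using Au by auto
  then show ?thesis
  proof cases
    case first
    then obtain B where "B \<in> GL2Z" "\<forall>z. lower_support Q (B *v z) = lower_support P (A *v pent z)"
      using lower_support_reflect[OF A v(1)] v(2) supportQ by metis
    then show ?thesis using support by (intro bexI[of _ B] bexI[of _ 1]) auto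
  next
    case second
    define S :: "real^2^2" where "S = vector [vector [0, 1], vector [1, 0]]"
    have S: "S \<in> GL2Z" by (simp add: GL2Z_iff det_2 S_def)
    have "w = (A ** S) *v axis 1 1"
      unfolding second by (simp add: S_def vec2_eq_iff flip: matrix_vector_mul_assoc)
    then obtain B where B: "B \<in> GL2Z" "\<forall>z. lower_support Q (B *v z) = lower_support P ((A ** S) *v pent z)"
      using lower_support_reflect[OF GL2Z_mult[OF A S] v(1)] v(2) supportQ by metis
    have "S *v pent (S *v z) = (pent ^^ 4) z" for z
      by (auto simp: eval_nat_numeral vec2_eq_iff min_def S_def)
    then have "lower_support Q ((B ** S) *v z) = f ((pent ^^ 4) z)" for z
      using B(2) support by (simp flip: matrix_vector_mul_assoc)
    then show ?thesis using B S by (intro bexI[of _ "B ** S"] bexI[of _ 4] GL2Z_mult) auto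
  qed
qed

section \<open>The mutation-equivalence class\<close>

theorem corollary3p18:
  fixes P E1 E2 :: "(real^2) set" and B :: "singularity list set"
  assumes "fano_polygon P"
    and "singularity_content P = (2, B)"
    and "T_cone_edges P = {#E1, E2#}"
    and "lattice_basis lattice_M (inner_normal P E1) (inner_normal P E2)"
  shows "finite (mutation_class P // {(Q, R). gl2_equivalent Q R}) \<and>
         card (mutation_class P // {(Q, R). gl2_equivalent Q R}) \<le> 5"
proof -
  obtain A where A: "A \<in> GL2Z" "A *v axis 1 1 = inner_normal P E1" "A *v axis 2 1 = inner_normal P E2"
    using GL2Z_of_basis assms(4) unfolding lattice_M_eq by metis
  define f where "f = (\<lambda>z. lower_support P (A *v z))"
  have f: "A2_pattern f" unfolding f_def by (rule A2_pattern_lower_support[OF assms(1,3) A])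
  have "pos_homogeneous f"
    using pos_homogeneous_lower_support[OF assms(1)]
    by (simp add: f_def pos_homogeneous_def matrix_vector_mult_scaleR)
  have pattern: "pos_homogeneous (f \<circ> pent ^^ k) \<and> A2_pattern (f \<circ> pent ^^ k)" for k
  proof (induction k)
    case (Suc k)
    then have "pos_homogeneous ((f \<circ> pent ^^ k) \<circ> pent) \<and> A2_pattern ((f \<circ> pent ^^ k) \<circ> pent)"
      using A2_pattern_pent pos_homogeneous_pent by blast
    then show ?case by (simp only: funpow_Suc_right comp_assoc)
  qed (simp add: f \<open>pos_homogeneous f\<close>)
  define state where
    "state = (\<lambda>k Q. \<exists>A\<in>GL2Z. \<forall>z. lower_support Q (A *v z) = f ((pent ^^ k) z))"
  have mod5: "(pent ^^ (k mod 5)) z = (pent ^^ k) z" for k z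
    by (rule funpow_mod_eq) (rule pent_period)
  have reach: "\<exists>k<5. state k Q" if "mutation_equivalent P Q" for Q
  proof -
    have "(\<lambda>X Y. is_mutation X Y \<or> gl2_equivalent X Y)\<^sup>*\<^sup>* P Q"
      using that by (simp add: mutation_equivalent_def)
    then show ?thesis
    proof induction
      case base
      have "state 0 P" unfolding state_def using A by (auto simp: f_def)
      then show ?case by (meson zero_less_numeral)
    next
      case (step X Y)
      then obtain k C where k: "k < 5" "C \<in> GL2Z" "\<And>z. lower_support X (C *v z) = (f \<circ> pent ^^ k) z"
        by (auto simp: state_def)
      from step(2) show ?case
      proof
        assume "is_mutation X Y"
        then obtain B j where B: "B \<in> GL2Z" "\<forall>z. lower_support Y (B *v z) = (f \<circ> pent ^^ k) ((pent ^^ j) z)"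
          using mutation_step[OF _ k(2,3)] pattern by blast
        then have "state ((k + j) mod 5) Y"
          by (auto simp: state_def mod5 funpow_add)
        then show ?case by (meson mod_less_divisor zero_less_numeral)
      next
        assume "gl2_equivalent X Y"
        then obtain B where B: "B \<in> GL2Z" "X = (*v) B ` Y"
          using gl2_equivalent_sym unfolding gl2_equivalent_def by blast
        then have "lower_support Y ((transpose B ** C) *v z) = f ((pent ^^ k) z)" for z
          using k(3)[of z] by (simp add: lower_support_image flip: matrix_vector_mul_assoc)
        then have "state k Y" unfolding state_def using B k GL2Z_mult GL2Z_transpose by blast
        then show ?case using k(1) by blast
      qed
    qed
  qed
  let ?r = "{(Q, R). gl2_equivalent Q R}"
  define rep where "rep = (\<lambda>k. SOME Q. Q \<in> mutation_class P \<and> state k Q)"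
  have "mutation_class P // ?r \<subseteq> (\<lambda>k. ?r `` {rep k}) ` {..<5}"
  proof
    fix X assume "X \<in> mutation_class P // ?r"
    then obtain Q where Q: "Q \<in> mutation_class P" "X = ?r `` {Q}" by (auto elim: quotientE)
    then obtain k where k: "k < 5" "state k Q" using reach by (auto simp: mutation_class_def)
    then have "rep k \<in> mutation_class P \<and> state k (rep k)"
      unfolding rep_def using Q by (intro someI) blast
    then have "gl2_equivalent Q (rep k)"
      using Q k gl2_equivalent_if_lower_support_eq
      unfolding state_def mutation_class_def mutation_equivalent_def by (smt (verit) mem_Collect_eq)
    then have "X = ?r `` {rep k}"
      using Q(2) gl2_equivalent_sym gl2_equivalent_trans by blast
    then show "X \<in> (\<lambda>k. ?r `` {rep k}) ` {..<5}" using k by blast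
  qed
  moreover have "card ((\<lambda>k. ?r `` {rep k}) ` {..<5::nat}) \<le> 5"
    using card_image_le[of "{..<5::nat}"] by simp
  ultimately show ?thesis by (meson card_mono finite_imageI finite_lessThan finite_subset le_trans)
qed

end
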